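(* Let $a,b,c$ be complex numbers and $n\ge 0$ an integer. (1) If $a+b$ is not a non-positive integer, then $$\frac{(a)^{(n)}(c-b)^{(n)}}{(a+b)^{(n)}}=\sum_{k=0}^n(-1)^k\binom{n}{k}\frac{(a+c+n-1)^{(k)}(c+k)^{(n-k)}(b)^{(k)}}{(a+b)^{(k)}}.$$ (2) If $c$ is not a non-positive integer, then $$\frac{(a)^{(n)}(b)^{(n)}}{(c)^{(n)}}=\sum_{k=0}^n(-1)^k\binom{n}{k}\frac{(b+c+n-1)^{(k)}(b+c-a+k)^{(n-k)}(c-a)^{(k)}}{(c)^{(k)}}.$$ (3) $$(a)^{(n)}(c-b)^{(n)}=\sum_{k=0}^n(-1)^k\binom{n}{k}(a+c+n-1)^{(k)}(c+k)^{(n-k)}(b)^{(k)}(a+b+k)^{(n-k)}.$$ (4) $$(a)^{(n)}(b)^{(n)}=\sum_{k=0}^n(-1)^k\binom{n}{k}(a+b+c+n-1)^{(k)}(c+b+k)^{(n-k)}(c)^{(k)}(a+c+k)^{(n-k)}.$$ (5) In particular, if $a+b\neq 1$, then $$(a+b-1)\sum_{j=0}^n(-1)^j\binom{n}{j}(a+b+j)^{(n-1)}=\delta_{n,0},$$ and, for all $a,b$, $$\sum_{j=0}^n(-1)^j\binom{n}{j}(a+b+j)^{(n-j)}(a+b+n-1)^{(j)}=\delta_{n,0}.$$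
   Context: Rising factorial: $(x)^{(n)}=x(x+1)\cdots(x+n-1)$, $(x)^{(0)}=1$; for $n=-1$ the formula $(x)^{(n)}=\Gamma(x+n)/\Gamma(x)$ gives the convention $(x)^{(-1)}=1/(x-1)$, used in (5) when $n=0$. $\delta_{n,0}$ is the Kronecker delta. *)

theory Defs
  imports "HOL-Analysis.Gamma_Function"
begin

text \<open>
  The rising factorial with an integer index, extending \<^const>\<open>pochhammer\<close> to negative indices
  by the formula \<open>Gamma (x + n) / Gamma x\<close>. The right-hand side is not used as the definition,
  because \<^const>\<open>Gamma\<close> takes the dummy value 0 at its poles; the quotient is cancelled instead.
\<close>

definition rising :: "complex \<Rightarrow> int \<Rightarrow> complex" where
  "rising x m = (if m \<ge> 0 then pochhammer x (nat m)
                 else 1 / pochhammer (x + of_int m) (nat (- m)))"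

lemma rising_of_nat: "rising x (int n) = pochhammer x n"
  by (simp add: rising_def)

lemma rising_minus_one: "rising x (-1) = 1 / (x - 1)"
  by (simp add: rising_def)

lemma rising_eq_Gamma:
  assumes "x \<notin> \<int>\<^sub>\<le>\<^sub>0" and "x + of_int m \<notin> \<int>\<^sub>\<le>\<^sub>0"
  shows "rising x m = Gamma (x + of_int m) / Gamma x"
proof (cases "m \<ge> 0")
  case True
  then have "(of_nat (nat m) :: complex) = of_int m" by simp
  with True pochhammer_Gamma[OF assms(1), of "nat m"] show ?thesis
    by (simp add: rising_def)
next
  case False
  then have "(of_nat (nat (- m)) :: complex) = - of_int m" by simp
  with False pochhammer_Gamma[OF assms(2), of "nat (- m)"] show ?thesis
    by (simp add: rising_def)
qed

end

theory Submission
  imports Defs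
begin

text \<open>
  The identity (3) is proved by induction on \<open>n\<close>, peeling off the first factors \<open>a (c - b)\<close> and
  using the induction hypothesis at \<open>a + 1, b, c + 1\<close>. In the \<open>k\<close>-th summand, the splitting
  \<open>a (c - b) = (c + k) (a + b + k) - (a + c + k) (b + k)\<close> produces multiples of the \<open>k\<close>-th and
  the \<open>(k + 1)\<close>-st summands for \<open>n + 1\<close>, and collecting coefficients is a form of Pascal's rule.
  The identities (1), (2) and (4) are (3) up to division and substitution. The sums in (5) are, up
  to a factor, \<open>n\<close>-th differences of a polynomial of degree \<open>n - 1\<close>.
\<close>

text \<open>Both sides are multiples of \<open>pochhammer (s + 1) k\<close>. The cofactors, linear
  in \<open>s\<close>, agree by the absorption identity (n + 1) C(n, k) = (k + 1) C(n + 1, k +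
  1).\<close>

lemma pochhammer_binomial_Pascal:
  fixes s :: "'a::comm_ring_1"
  shows "of_nat (Suc n choose Suc k) * pochhammer s (Suc k) =
    of_nat (n choose Suc k) * pochhammer (s + 1) (Suc k)
    + of_nat (n choose k) * pochhammer (s + 1) k * (s - of_nat n + of_nat k)"
proof -
  define x y :: 'a where "x = of_nat (n choose k)" and "y = of_nat (n choose Suc k)"
  have "of_nat (Suc n * (n choose k)) = (of_nat ((Suc n choose Suc k) * Suc k) :: 'a)"
    by (simp only: Suc_times_binomial_eq)
  then have "(1 + of_nat n) * x = (x + y) * (1 + of_nat k)"
    by (simp add: x_def y_def algebra_simps)
  then have "(x + y) * s = y * (s + 1 + of_nat k) + x * (s - of_nat n + of_nat k)"
    by (simp add: algebra_simps)
  then have "(x + y) * s * pochhammer (s + 1) k =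
      (y * (s + 1 + of_nat k) + x * (s - of_nat n + of_nat k)) * pochhammer (s + 1) k"
    by simp
  then show ?thesis
    unfolding pochhammer_rec[of s] pochhammer_Suc[of "s + 1"] x_def y_def
    by (simp add: algebra_simps)
qed

lemma pochhammer_mult_expansion:
  fixes a b c :: "'a::comm_ring_1"
  shows "pochhammer a n * pochhammer (c - b) n =
    (\<Sum>k\<le>n. (-1) ^ k * of_nat (n choose k) *
      pochhammer (a + c + of_nat n - 1) k * pochhammer (c + of_nat k) (n - k)
      * pochhammer b k * pochhammer (a + b + of_nat k) (n - k))"
proof (induction n arbitrary: a c)
  case 0
  show ?case by simp
next
  case (Suc n)
  \<comment> \<open>\<open>T k\<close> is the summand for \<open>Suc n\<close>; for k \<le> n,
    \<open>U k\<close> and \<open>V k\<close> are the two pieces of \<open>a * (c - b)\<close> times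
    the summand of the induction hypothesis. The parameter a + c + n - 1 becomes \<open>s\<close> in
    the former and \<open>s + 1\<close> in the latter.\<close>
  define s where "s = a + c + of_nat n"
  define e where "e k = pochhammer b k * pochhammer (a + b + of_nat k) (Suc n - k)" for k
  define U where "U k = (-1) ^ k * of_nat (n choose k) * pochhammer (s + 1) k
    * pochhammer (c + of_nat k) (Suc n - k) * e k" for k
  define V where "V k = - ((-1) ^ k * of_nat (n choose k) * pochhammer (s + 1) k
    * (s - of_nat n + of_nat k) * pochhammer (c + of_nat k + 1) (n - k) * e (Suc k))" for k
  define T where "T k = (-1) ^ k * of_nat (Suc n choose k) * pochhammer s k
    * pochhammer (c + of_nat k) (Suc n - k) * e k" for k
  \<comment> \<open>Pascal's rule above, multiplied by the common factor \<open>p\<close>, whose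
    sign accounts for the minus in \<open>V k\<close>.\<close>
  have T_Suc: "T (Suc k) = U (Suc k) + V k" for k
  proof -
    define p where "p = (-1) ^ Suc k * pochhammer (c + of_nat (Suc k)) (n - k) * e (Suc k)"
    have "T (Suc k) = of_nat (Suc n choose Suc k) * pochhammer s (Suc k) * p"
      by (simp add: T_def p_def mult_ac)
    also have "\<dots> = U (Suc k) + V k"
      unfolding pochhammer_binomial_Pascal
      by (simp add: U_def V_def p_def algebra_simps del: binomial_Suc_Suc)
    finally show ?thesis .
  qed
  have UV: "U k + V k = a * (c - b) * ((-1) ^ k * of_nat (n choose k) *
      pochhammer ((a + 1) + (c + 1) + of_nat n - 1) k * pochhammer ((c + 1) + of_nat k) (n - k)
      * pochhammer b k * pochhammer ((a + 1) + b + of_nat k) (n - k))"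
    if "k \<le> n" for k
  proof -
    define w where "w = (-1) ^ k * of_nat (n choose k) * pochhammer (s + 1) k
      * pochhammer (c + of_nat k + 1) (n - k) * pochhammer b k
      * pochhammer (a + b + of_nat k + 1) (n - k)"
    have "e k = pochhammer b k *
        ((a + b + of_nat k) * pochhammer (a + b + of_nat k + 1) (n - k))"
      using that by (simp add: e_def Suc_diff_le pochhammer_rec)
    moreover have "pochhammer (c + of_nat k) (Suc n - k) =
        (c + of_nat k) * pochhammer (c + of_nat k + 1) (n - k)"
      using that by (simp add: Suc_diff_le pochhammer_rec)
    ultimately have "U k = (c + of_nat k) * (a + b + of_nat k) * w"
      by (simp add: U_def w_def mult_ac)
    \<comment> \<open>Here s - n is a + c, and the factor b + k is the last one of
      \<open>pochhammer b (Suc k)\<close> in \<open>e (Suc k)\<close>.\<close>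
    moreover have "V k = - ((a + c + of_nat k) * (b + of_nat k) * w)"
      by (simp add: V_def w_def e_def s_def pochhammer_Suc mult_ac add_ac)
    ultimately have "U k + V k = ((c + of_nat k) * (a + b + of_nat k)
        - (a + c + of_nat k) * (b + of_nat k)) * w"
      by (simp only: left_diff_distrib add_uminus_conv_diff)
    also have "\<dots> = a * (c - b) * w"
      by (simp add: algebra_simps)
    finally have "U k + V k = a * (c - b) * w" .
    then show ?thesis
      by (simp add: w_def s_def add_ac mult_ac)
  qed
  have "pochhammer a (Suc n) * pochhammer (c - b) (Suc n) =
      a * (c - b) * (pochhammer (a + 1) n * pochhammer ((c + 1) - b) n)"
    by (simp add: pochhammer_rec algebra_simps)
  also have "\<dots> = (\<Sum>k\<le>n. U k + V k)"
    unfolding Suc.IH sum_distrib_left by (intro sum.cong) (simp_all only: UV atMost_iff)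
  \<comment> \<open>The added term \<open>U (Suc n)\<close> vanishes because C(n, n + 1) = 0. The
    shift then pairs \<open>U (Suc k)\<close> with \<open>V k\<close>, and \<open>U 0\<close> equals
    \<open>T 0\<close>.\<close>
  also have "\<dots> = (\<Sum>k\<le>Suc n. U k) + (\<Sum>k\<le>n. V k)"
    by (simp add: sum.distrib U_def binomial_eq_0)
  also have "\<dots> = U 0 + (\<Sum>k\<le>n. T (Suc k))"
    by (simp only: T_Suc sum.distrib sum.atMost_Suc_shift add.assoc)
  also have "\<dots> = (\<Sum>k\<le>Suc n. T k)"
    by (simp only: sum.atMost_Suc_shift) (simp add: U_def T_def)
  finally show ?case
    by (simp only: T_def e_def s_def of_nat_Suc mult.assoc) (simp add: algebra_simps)
qed

lemma pochhammer_mult_div_expansion: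
  fixes a b c :: "'a::field_char_0"
  assumes "a + b \<notin> \<int>\<^sub>\<le>\<^sub>0"
  shows "pochhammer a n * pochhammer (c - b) n / pochhammer (a + b) n =
    (\<Sum>k\<le>n. (-1) ^ k * of_nat (n choose k) *
      (pochhammer (a + c + of_nat n - 1) k * pochhammer (c + of_nat k) (n - k)
        * pochhammer b k / pochhammer (a + b) k))"
proof -
  have nz: "pochhammer (a + b) m \<noteq> 0" for m
    using assms by (auto simp: pochhammer_eq_0_iff)
  \<comment> \<open>The product over n factors splits after the first k, so dividing the previous
    expansion by it cancels the tail and leaves the head in the denominator.\<close>
  have "pochhammer (a + b + of_nat k) (n - k) / pochhammer (a + b) n =
      inverse (pochhammer (a + b) k)"
    if "k \<le> n" for k
    using nz[of k] nz[of n] pochhammer_product[OF that, of "a + b"] by (simp add: field_simps)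
  then show ?thesis
    unfolding pochhammer_mult_expansion sum_divide_distrib
    by (intro sum.cong refl) (simp only: times_divide_eq_right[symmetric] mult.assoc
        divide_inverse[of _ "pochhammer (a + b) _"] atMost_iff)
qed

text \<open>Pascal's rule turns the difference of order n + 1 into one of order n applied to a first
  difference, and a first difference lowers the degree m by one or kills a constant.\<close>

lemma pochhammer_nth_difference_eq_0:
  fixes x :: "'a::comm_ring_1"
  assumes "m < n"
  shows "(\<Sum>j\<le>n. (-1) ^ j * of_nat (n choose j) * pochhammer (x + of_nat j) m) = 0"
  using assms
proof (induction n arbitrary: m x)
  case 0
  then show ?case by simp
next
  case (Suc n)
  have "(\<Sum>j\<le>Suc n. (-1) ^ j * of_nat (Suc n choose j) * pochhammer (x + of_nat j) m) =
      pochhammer x m + (\<Sum>j\<le>n. (-1) ^ Suc j * of_nat (n choose Suc j)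
        * pochhammer (x + of_nat (Suc j)) m)
      + (\<Sum>j\<le>n. (-1) ^ Suc j * of_nat (n choose j) * pochhammer (x + of_nat (Suc j)) m)"
    unfolding sum.atMost_Suc_shift by (simp add: sum.distrib[symmetric] algebra_simps)
  \<comment> \<open>The isolated \<open>pochhammer x m\<close> is the term for j = 0.\<close>
  also have "pochhammer x m + (\<Sum>j\<le>n. (-1) ^ Suc j * of_nat (n choose Suc j)
        * pochhammer (x + of_nat (Suc j)) m) =
      (\<Sum>j\<le>Suc n. (-1) ^ j * of_nat (n choose j) * pochhammer (x + of_nat j) m)"
    unfolding sum.atMost_Suc_shift by simp
  also have "\<dots> = (\<Sum>j\<le>n. (-1) ^ j * of_nat (n choose j) * pochhammer (x + of_nat j) m)"
    by (simp add: binomial_eq_0)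
  also have "\<dots> + (\<Sum>j\<le>n. (-1) ^ Suc j * of_nat (n choose j)
        * pochhammer (x + of_nat (Suc j)) m) =
      (\<Sum>j\<le>n. (-1) ^ j * of_nat (n choose j)
        * (pochhammer (x + of_nat j) m - pochhammer (x + of_nat j + 1) m))"
    by (simp add: sum.distrib[symmetric] algebra_simps)
  also have "\<dots> = 0"
  proof (cases m)
    case 0
    then show ?thesis by simp
  next
    case (Suc l)
    have diff: "pochhammer y (Suc l) - pochhammer (y + 1) (Suc l) =
        - of_nat (Suc l) * pochhammer (y + 1) l" for y :: 'a
      unfolding pochhammer_rec[of y] pochhammer_Suc[of "y + 1"] by (simp add: algebra_simps)
    have "(\<Sum>j\<le>n. (-1) ^ j * of_nat (n choose j)
          * (pochhammer (x + of_nat j) m - pochhammer (x + of_nat j + 1) m)) =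
        - of_nat (Suc l) * (\<Sum>j\<le>n. (-1) ^ j * of_nat (n choose j)
          * pochhammer ((x + 1) + of_nat j) l)"
      unfolding Suc sum_distrib_left diff by (intro sum.cong refl)
        (simp only: add_ac mult_ac)
    also have "\<dots> = 0"
      using Suc.IH[of l "x + 1"] Suc.prems Suc by simp
    finally show ?thesis .
  qed
  finally show ?case .
qed

text \<open>The two products run over x + j, ..., x + m and x + m, ..., x + m + j - 1. Taking out
  one factor x + m merges them into the single run x + j, ..., x + j + m - 1.\<close>

lemma pochhammer_overlap:
  fixes x :: "'a::comm_ring_1"
  assumes "j \<le> Suc m"
  shows "pochhammer (x + of_nat j) (Suc m - j) * pochhammer (x + of_nat m) j =
    (x + of_nat m) * pochhammer (x + of_nat j) m"
proof (cases j)
  case 0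
  then show ?thesis by (simp add: pochhammer_Suc mult.commute)
next
  case (Suc i)
  with assms have "i \<le> m" by simp
  have "(x + of_nat i + 1) + of_nat (m - i) = x + of_nat m + 1"
    using \<open>i \<le> m\<close> by (simp add: of_nat_diff)
  then have "pochhammer (x + of_nat i + 1) m =
      pochhammer (x + of_nat i + 1) (m - i) * pochhammer (x + of_nat m + 1) i"
    using pochhammer_product[of "m - i" m "x + of_nat i + 1"] \<open>i \<le> m\<close>
    by (simp only: diff_le_self diff_diff_cancel)
  then show ?thesis
    using Suc by (simp add: pochhammer_rec[of "x + of_nat m"] algebra_simps)
qed

lemma alternating_sum_pochhammer_overlap:
  fixes x :: "'a::comm_ring_1"
  shows "(\<Sum>j\<le>n. (-1) ^ j * of_nat (n choose j) *
      pochhammer (x + of_nat j) (n - j) * pochhammer (x + of_nat n - 1) j) =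
    (if n = 0 then 1 else 0)"
proof (cases n)
  case 0
  then show ?thesis by simp
next
  case (Suc m)
  have "(\<Sum>j\<le>n. (-1) ^ j * of_nat (n choose j) *
        pochhammer (x + of_nat j) (n - j) * pochhammer (x + of_nat n - 1) j) =
      (x + of_nat m) *
        (\<Sum>j\<le>n. (-1) ^ j * of_nat (n choose j) * pochhammer (x + of_nat j) m)"
    unfolding sum_distrib_left
  proof (intro sum.cong refl)
    fix j assume "j \<in> {..n}"
    with Suc have "pochhammer (x + of_nat j) (n - j) * pochhammer (x + of_nat n - 1) j =
        (x + of_nat m) * pochhammer (x + of_nat j) m"
      using pochhammer_overlap[of j m x] by simp
    then show "(-1) ^ j * of_nat (n choose j) *
          pochhammer (x + of_nat j) (n - j) * pochhammer (x + of_nat n - 1) j =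
        (x + of_nat m) * ((-1) ^ j * of_nat (n choose j) * pochhammer (x + of_nat j) m)"
      by (simp only: mult.assoc mult.left_commute)
  qed
  with Suc show ?thesis
    by (simp only: pochhammer_nth_difference_eq_0) simp
qed

lemma alternating_sum_rising:
  assumes "x \<noteq> 1"
  shows "(x - 1) *
      (\<Sum>j\<le>n. (-1) ^ j * of_nat (n choose j) * rising (x + of_nat j) (int n - 1)) =
    (if n = 0 then 1 else 0)"
proof (cases n)
  case 0
  \<comment> \<open>The only summand is \<open>rising x (-1)\<close>, that is 1 / (x - 1), which
    cancels against the prefactor because x differs from 1.\<close>
  with assms show ?thesis by (simp add: rising_minus_one)
next
  case (Suc m)
  then have "rising y (int n - 1) = pochhammer y m" for y
    by (simp add: rising_of_nat)
  with Suc show ?thesis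
    by (simp only: pochhammer_nth_difference_eq_0) simp
qed

theorem corollary1:
  fixes a b c :: complex and n :: nat
  shows
    "(a + b \<notin> \<int>\<^sub>\<le>\<^sub>0 \<longrightarrow>
        pochhammer a n * pochhammer (c - b) n / pochhammer (a + b) n =
        (\<Sum>k=0..n. (-1) ^ k * of_nat (n choose k) *
           (pochhammer (a + c + of_nat n - 1) k * pochhammer (c + of_nat k) (n - k)
              * pochhammer b k / pochhammer (a + b) k)))
   \<and> (c \<notin> \<int>\<^sub>\<le>\<^sub>0 \<longrightarrow>
        pochhammer a n * pochhammer b n / pochhammer c n =
        (\<Sum>k=0..n. (-1) ^ k * of_nat (n choose k) *
           (pochhammer (b + c + of_nat n - 1) k * pochhammer (b + c - a + of_nat k) (n - k)
              * pochhammer (c - a) k / pochhammer c k)))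
   \<and> pochhammer a n * pochhammer (c - b) n =
        (\<Sum>k=0..n. (-1) ^ k * of_nat (n choose k) *
           pochhammer (a + c + of_nat n - 1) k * pochhammer (c + of_nat k) (n - k)
              * pochhammer b k * pochhammer (a + b + of_nat k) (n - k))
   \<and> pochhammer a n * pochhammer b n =
        (\<Sum>k=0..n. (-1) ^ k * of_nat (n choose k) *
           pochhammer (a + b + c + of_nat n - 1) k * pochhammer (c + b + of_nat k) (n - k)
              * pochhammer c k * pochhammer (a + c + of_nat k) (n - k))
   \<and> (a + b \<noteq> 1 \<longrightarrow>
        (a + b - 1) *
          (\<Sum>j=0..n. (-1) ^ j * of_nat (n choose j) * rising (a + b + of_nat j) (int n - 1)) =
        (if n = 0 then 1 else 0))
   \<and> (\<Sum>j=0..n. (-1) ^ j * of_nat (n choose j) *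
           pochhammer (a + b + of_nat j) (n - j) * pochhammer (a + b + of_nat n - 1) j) =
        (if n = 0 then 1 else 0)"
  \<comment> \<open>(2) is (1) with c - a for b and b + c - a for c, so that a + b becomes c and c -
    b becomes b. (4) is (3) with c for b and c + b for c.\<close>
  using pochhammer_mult_div_expansion[of a b n c]
    pochhammer_mult_div_expansion[of a "c - a" n "b + c - a"]
    pochhammer_mult_expansion[of a n c b] pochhammer_mult_expansion[of a n "c + b" c]
    alternating_sum_rising[of "a + b" n] alternating_sum_pochhammer_overlap[of n "a + b"]
  unfolding atMost_atLeast0 by (simp add: add_ac)

end
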